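(* If $\Gamma$ and $\Pi$ are two tournaments on a finite set $I$ with the same scores and $d(\Gamma,\Pi) = k$, then there are at least $k!$ geodesics connecting $\Gamma$ and $\Pi$ in the interchange graph.
   Context: A tournament on $I$ is a relation $\Pi\subset I\times I$ without loops such that for distinct $i,j$ exactly one of $(i,j),(j,i)$ is in $\Pi$. Tournaments $\Pi,\Gamma$ on $I$ have the same scores if $|\{j:(i,j)\in\Pi\}|=|\{j:(i,j)\in\Gamma\}|$ for all $i\in I$. A $3$-cycle in $\Gamma$ is a subset $C=\{(i_1,i_2),(i_2,i_3),(i_3,i_1)\}\subset\Gamma$ with $i_1,i_2,i_3$ distinct; reversing it replaces $\Gamma$ by $(\Gamma\setminus C)\cup C^{-1}$, where $C^{-1}=\{(j,i):(i,j)\in C\}$. The interchange graph is the undirected graph whose vertices are the tournaments on $I$ with the given scores, with two tournaments joined by an edge when each is obtained from the other by reversing a single $3$-cycle (this graph is connected). $d$ is the graph distance, and a geodesic between two vertices is a path $[x_0,\dots,x_k]$ of minimum length between them. *)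

theory Defs
  imports "Graph_Theory.Graph_Theory"
begin

definition tournament :: "'a set \<Rightarrow> 'a rel \<Rightarrow> bool" where
  "tournament I G \<longleftrightarrow> G \<subseteq> I \<times> I \<and> irrefl G \<and>
     (\<forall>i\<in>I. \<forall>j\<in>I. i \<noteq> j \<longrightarrow> ((i, j) \<in> G \<longleftrightarrow> (j, i) \<notin> G))"

definition score :: "'a rel \<Rightarrow> 'a \<Rightarrow> nat" where
  "score G i = card {j. (i, j) \<in> G}"

definition same_scores :: "'a set \<Rightarrow> 'a rel \<Rightarrow> 'a rel \<Rightarrow> bool" where
  "same_scores I G H \<longleftrightarrow> (\<forall>i\<in>I. score G i = score H i)"

definition three_cycle :: "'a rel \<Rightarrow> 'a rel \<Rightarrow> bool" where
  "three_cycle G C \<longleftrightarrow> C \<subseteq> G \<and>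
     (\<exists>i1 i2 i3. distinct [i1, i2, i3] \<and> C = {(i1, i2), (i2, i3), (i3, i1)})"

definition reversal :: "'a rel \<Rightarrow> 'a rel \<Rightarrow> bool" where
  "reversal G H \<longleftrightarrow> (\<exists>C. three_cycle G C \<and> H = (G - C) \<union> C\<inverse>)"

text \<open>Undirected graphs are symmetric digraphs, as usual in this graph library.\<close>

definition interchange_graph :: "'a set \<Rightarrow> ('a \<Rightarrow> nat) \<Rightarrow> 'a rel pair_pre_digraph" where
  "interchange_graph I s =
     (let V = {G. tournament I G \<and> (\<forall>i\<in>I. score G i = s i)}
      in \<lparr> pverts = V,
           parcs = {(G, H). G \<in> V \<and> H \<in> V \<and> reversal G H \<and> reversal H G} \<rparr>)"

text \<open>The length of a walk is its cost for unit weights, so the graph distance is the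
  weighted distance for unit weights; it is infinite between different components.\<close>

definition graph_distance :: "('v, 'e) pre_digraph \<Rightarrow> 'v \<Rightarrow> 'v \<Rightarrow> ereal" where
  "graph_distance D u v = wf_digraph.\<mu> D (\<lambda>_. 1) u v"

definition geodesics :: "('v, 'e) pre_digraph \<Rightarrow> 'v \<Rightarrow> 'v \<Rightarrow> 'v vwalk set" where
  "geodesics D u v =
     {p. vpath p D \<and> hd p = u \<and> last p = v \<and>
         ereal (real (vwalk_length p)) = graph_distance D u v}"

lemma reversal_neq:
  assumes "reversal G H"
  shows "G \<noteq> H"
  using assms unfolding reversal_def three_cycle_def by fastforce

text \<open>The constant behind \<open>graph_distance\<close> lives in the locale of well-formed digraphs;
  the following makes its theory available for interchange graphs.\<close>

lemma pair_graph_interchange_graph: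
  assumes "finite I"
  shows "pair_graph (interchange_graph I s)"
proof
  let ?D = "interchange_graph I s"
  have sub: "pverts ?D \<subseteq> Pow (I \<times> I)"
    by (auto simp: interchange_graph_def tournament_def)
  then show fin: "finite (pverts ?D)"
    using assms by (auto intro: finite_subset)
  show arc1: "fst e \<in> pverts ?D" if "e \<in> parcs ?D" for e
    using that by (auto simp: interchange_graph_def)
  show arc2: "snd e \<in> pverts ?D" if "e \<in> parcs ?D" for e
    using that by (auto simp: interchange_graph_def)
  show "finite (parcs ?D)"
    by (rule finite_subset[of _ "pverts ?D \<times> pverts ?D"])
       (use fin arc1 arc2 in \<open>auto simp: mem_Times_iff\<close>)
  show "symmetric (with_proj ?D)"
    by (auto simp: symmetric_def interchange_graph_def sym_def)
  show "fst e \<noteq> snd e" if "e \<in> parcs ?D" for e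
    using that reversal_neq[of "fst e" "snd e"] by (auto simp: interchange_graph_def)
qed

end

theory Submission
  imports Defs
begin

text \<open>Let \<open>D = G - P\<close>. The distance from \<open>G\<close> to \<open>P\<close> is the least value of \<open>|D| - 2q\<close> over all
  decompositions of \<open>D\<close> into \<open>q\<close> closed trails. Reversing a triangle \<open>T\<close> adds \<open>T\<inverse>\<close> to \<open>D\<close> and
  cancels the resulting 2-cycles, and cancelling a 2-cycle costs at most one trail; so this number
  changes by at most one, and it drops whenever \<open>D + T\<inverse>\<close> splits into \<open>q + 2\<close> closed trails.

  It is enough that \<open>G\<close> has at least \<open>k\<close> neighbours at distance \<open>k - 1\<close> from \<open>P\<close>, since then the
  number of geodesics is at least \<open>k (k - 1)! = k!\<close> by induction. To find them, take a shortest
  cycle \<open>C\<close> among all parts of optimal decompositions of \<open>D\<close>; it is induced in \<open>D\<close>. Send each vertex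
  \<open>u\<close> of \<open>C\<close> to the triangle \<open>u \<rightarrow> w \<rightarrow> w' \<rightarrow> u\<close>, where \<open>w\<close> is the last out-neighbour of \<open>u\<close> met along
  \<open>C\<close> and \<open>w'\<close> its successor. Two vertices share a triangle only if one of them has out-degree 1
  inside \<open>C\<close>, and for \<open>|C| > 3\<close> there are at most two of these; so \<open>C\<close> yields \<open>|C| - 2\<close> triangles. Each
  has an arc in \<open>C\<close> and, \<open>C\<close> being induced, none in \<open>D - C\<close>, so it differs from the triangles
  produced recursively by \<open>D - C\<close>.\<close>

section \<open>Trails and decompositions into closed trails\<close>

text \<open>Only the multiset of arcs is kept, so that rotating, cutting and splicing closed trails
  become multiset equations.\<close>

inductive arc_trail :: "'a \<Rightarrow> ('a \<times> 'a) multiset \<Rightarrow> 'a \<Rightarrow> bool" where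
  arc_trail_empty: "arc_trail a {#} a"
| arc_trail_add: "arc_trail b M c \<Longrightarrow> arc_trail a (add_mset (a, b) M) c"

lemma arc_trail_append: "arc_trail a M b \<Longrightarrow> arc_trail b N c \<Longrightarrow> arc_trail a (M + N) c"
  by (induction rule: arc_trail.induct) (auto intro: arc_trail.intros)

lemma arc_trail_single: "arc_trail a {#(a, b)#} b"
  by (rule arc_trail_add[OF arc_trail_empty])

lemma arc_trail_emptyD: "arc_trail a {#} b \<Longrightarrow> a = b"
  by (auto elim: arc_trail.cases)

lemma arc_trail_split:
  assumes "arc_trail a M b" "(x, y) \<in># M"
  shows "\<exists>M1 M2. arc_trail a M1 x \<and> arc_trail y M2 b \<and> M = add_mset (x, y) (M1 + M2)"
  using assms
proof (induction rule: arc_trail.induct)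
  case (arc_trail_add b M c a)
  show ?case
  proof (cases "(x, y) = (a, b)")
    case True
    then show ?thesis
      using arc_trail_add.hyps arc_trail_empty by (intro exI[of _ "{#}"] exI[of _ M]) auto
  next
    case False
    then obtain M1 M2 where "arc_trail b M1 x" "arc_trail y M2 c" "M = add_mset (x, y) (M1 + M2)"
      using arc_trail_add by auto
    then show ?thesis
      by (intro exI[of _ "add_mset (a, b) M1"] exI[of _ M2]) (auto intro: arc_trail.arc_trail_add)
  qed
qed simp

lemma closed_trail_cut:
  assumes "arc_trail a M a" "(x, y) \<in># M"
  shows "\<exists>K. arc_trail y K x \<and> M = add_mset (x, y) K"
proof -
  obtain M1 M2 where "arc_trail a M1 x" "arc_trail y M2 a" "M = add_mset (x, y) (M1 + M2)"
    using arc_trail_split[OF assms] by blast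
  then show ?thesis
    by (intro exI[of _ "M2 + M1"]) (auto intro: arc_trail_append)
qed

inductive splits :: "('a \<times> 'a) multiset \<Rightarrow> nat \<Rightarrow> bool" where
  splits_empty: "splits {#} 0"
| splits_add: "splits M n \<Longrightarrow> arc_trail a K a \<Longrightarrow> K \<noteq> {#} \<Longrightarrow> splits (M + K) (Suc n)"

lemma splits_closed: "arc_trail a K a \<Longrightarrow> K \<noteq> {#} \<Longrightarrow> splits K 1"
  using splits_add[OF splits_empty] by simp

lemma splits_union: "splits N n \<Longrightarrow> splits M m \<Longrightarrow> splits (M + N) (m + n)"
  by (induction rule: splits.induct) (auto simp flip: add.assoc intro: splits.intros)

lemma splits_0D: "splits M 0 \<Longrightarrow> M = {#}"
  by (auto elim: splits.cases)

lemma splits_le_size: "splits M n \<Longrightarrow> n \<le> size M"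
proof (induction rule: splits.induct)
  case (splits_add M n a K)
  then have "size K > 0"
    by (simp add: nonempty_has_size)
  then show ?case
    using splits_add by simp
qed simp

lemma splits_part:
  assumes "splits M n" "(x, y) \<in># M"
  shows "\<exists>N K m. splits N m \<and> n = Suc m \<and> arc_trail y K x \<and> M = add_mset (x, y) (N + K)"
  using assms
proof (induction rule: splits.induct)
  case (splits_add M n a K)
  show ?case
  proof (cases "(x, y) \<in># K")
    case True
    then obtain K' where "arc_trail y K' x" "K = add_mset (x, y) K'"
      using closed_trail_cut[OF splits_add.hyps(2)] by blast
    then show ?thesis
      using splits_add.hyps by auto
  next
    case False
    then obtain N L m where *: "splits N m" "n = Suc m" "arc_trail y L x" "M = add_mset (x, y) (N + L)"
      using splits_add by auto
    then have "splits (N + K) n"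
      using splits.splits_add[OF *(1) splits_add.hyps(2,3)] *(2) by simp
    then show ?thesis
      using * by (intro exI[of _ "N + K"] exI[of _ L] exI[of _ n]) auto
  qed
qed simp

section \<open>Cancelling 2-cycles\<close>

lemma splits_add_closed:
  assumes "splits M n" "arc_trail a K a"
  shows "\<exists>n'\<ge>n. splits (M + K) n'"
proof (cases "K = {#}")
  case False
  then show ?thesis
    using splits_add[OF assms] by (auto intro!: exI[of _ "Suc n"])
qed (use assms in auto)

text \<open>If both arcs lie in one part, the rest of it falls into two closed trails, either
  possibly empty, so at most one part is lost. If they lie in different parts, the remainders join
  into one closed trail.\<close>

lemma splits_cancel_2cycle:
  assumes "splits (M + {#(a, b), (b, a)#}) n" "a \<noteq> b"
  shows "\<exists>n'. n \<le> Suc n' \<and> splits M n'"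
proof -
  obtain N K m where 1: "splits N m" "n = Suc m" "arc_trail b K a"
    and eq: "M + {#(a, b), (b, a)#} = add_mset (a, b) (N + K)"
    using splits_part[OF assms(1), of a b] by auto
  then have M: "add_mset (b, a) M = N + K"
    by (simp add: add_mset_commute)
  show ?thesis
  proof (cases "(b, a) \<in># K")
    case True
    then obtain K1 K2 where K: "arc_trail b K1 b" "arc_trail a K2 a" "K = add_mset (b, a) (K1 + K2)"
      using arc_trail_split[OF 1(3)] by blast
    then have MN: "M = N + K1 + K2"
      using M by (simp add: ac_simps)
    obtain n1 where n1: "n1 \<ge> m" "splits (N + K1) n1"
      using splits_add_closed[OF 1(1) K(1)] by blast
    obtain n2 where "n2 \<ge> n1" "splits M n2"
      using splits_add_closed[OF n1(2) K(2)] MN by blast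
    then show ?thesis
      using 1(2) n1(1) by (auto intro!: exI[of _ n2])
  next
    case False
    then have "(b, a) \<in># N"
      using arg_cong[OF M, of "\<lambda>L. (b, a) \<in># L"] by simp
    then obtain N' L l where 2: "splits N' l" "m = Suc l" "arc_trail a L b" "N = add_mset (b, a) (N' + L)"
      using splits_part[OF 1(1)] by blast
    have "arc_trail a (L + K) a"
      using arc_trail_append[OF 2(3) 1(3)] .
    moreover have "L + K \<noteq> {#}"
      using 1(3) assms(2) by (auto dest: arc_trail_emptyD)
    ultimately have "splits (N' + (L + K)) (Suc l)"
      using splits_add[OF 2(1)] by blast
    moreover have "M = N' + (L + K)"
      using M 2(4) by (simp add: ac_simps)
    ultimately show ?thesis
      using 1(2) 2(2) by auto
  qed
qed

lemma splits_cancel: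
  assumes "finite X" "\<And>x. (x, x) \<notin> X"
    and "splits (M + mset_set X + image_mset prod.swap (mset_set X)) n"
  shows "\<exists>n'. n \<le> n' + card X \<and> splits M n'"
  using assms
proof (induction X arbitrary: n rule: finite_induct)
  case (insert e X)
  obtain a b where e: "e = (a, b)"
    by fastforce
  define Y where "Y = M + mset_set X + image_mset prod.swap (mset_set X)"
  have "M + mset_set (insert e X) + image_mset prod.swap (mset_set (insert e X)) = Y + {#(a, b), (b, a)#}"
    using insert.hyps by (simp add: e Y_def)
  then have Y: "splits (Y + {#(a, b), (b, a)#}) n"
    using insert.prems(2) by simp
  have "a \<noteq> b"
    using insert.prems(1) e by auto
  from splits_cancel_2cycle[OF Y this] obtain n1 where n1: "n \<le> Suc n1" "splits Y n1"
    by blast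
  have "(x, x) \<notin> X" for x
    using insert.prems(1) by blast
  from insert.IH[OF this n1(2)[unfolded Y_def]] obtain n2 where "n1 \<le> n2 + card X" "splits M n2"
    by blast
  then show ?case
    using n1 insert.hyps by (intro exI[of _ n2]) auto
qed auto

section \<open>Reversing a triangle\<close>

text \<open>\<open>|D| - 2q \<le> n\<close>, without truncated subtraction.\<close>

definition cost_le :: "'a rel \<Rightarrow> nat \<Rightarrow> bool" where
  "cost_le D n \<longleftrightarrow> (\<exists>q. splits (mset_set D) q \<and> card D \<le> n + 2 * q)"

lemma image_swap_mset_set: "finite T \<Longrightarrow> image_mset prod.swap (mset_set T) = mset_set (T\<inverse>)"
proof -
  have "prod.swap ` T = T\<inverse>"
    by force
  then show ?thesis
    by (simp add: image_mset_mset_set)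
qed

lemma mset_set_split_Int: "finite D \<Longrightarrow> mset_set D = mset_set (D - T) + mset_set (T \<inter> D)"
  by (subst mset_set_Union[symmetric]) (auto intro: arg_cong[of _ _ mset_set])

text \<open>With \<open>X\<close> the arcs of \<open>T\<close> in \<open>D\<close>, the multiset
  \<open>D + T\<inverse>\<close> is the new difference plus the 2-cycles on \<open>X\<close>.
  Cancelling these costs at most \<open>card X\<close> parts, while the new difference has
  \<open>card D + card T - 2 * card X\<close> arcs, so \<open>X\<close> drops out of the
  estimate.\<close>

lemma splits_reversal:
  assumes "finite G" "asym G" "T \<subseteq> G"
    and "splits (mset_set (G - P) + mset_set (T\<inverse>)) n"
    and P: "\<And>x y. (x, y) \<in> T \<Longrightarrow> (x, y) \<in> P \<longleftrightarrow> (y, x) \<notin> P"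
  shows "\<exists>q. splits (mset_set ((G - T) \<union> T\<inverse> - P)) q \<and>
    card ((G - T) \<union> T\<inverse> - P) + 2 * n \<le> card (G - P) + card T + 2 * q"
proof -
  define D X where "D = G - P" and "X = T - P"
  let ?D' = "(G - T) \<union> T\<inverse> - P"
  have fin: "finite D" "finite T" "finite X"
    using assms(1,3) by (auto simp: D_def X_def intro: finite_subset)
  have D': "?D' = (D - T) \<union> (T - X)\<inverse>"
    using P by (auto simp: D_def X_def)
  have disj: "(D - T) \<inter> (T - X)\<inverse> = {}"
    using assms(2,3) by (auto simp: D_def asym_on_def)
  have TD: "T \<inter> D = X" "X \<subseteq> T"
    using assms(3) by (auto simp: D_def X_def)
  have m1: "mset_set D = mset_set (D - T) + mset_set X"
    using mset_set_split_Int[OF fin(1), of T] TD by simp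
  have "X\<inverse> \<inter> T\<inverse> = X\<inverse>" "T\<inverse> - X\<inverse> = (T - X)\<inverse>"
    using TD by auto
  then have m2: "mset_set (T\<inverse>) = mset_set ((T - X)\<inverse>) + mset_set (X\<inverse>)"
    using mset_set_split_Int[of "T\<inverse>" "X\<inverse>"] fin by simp
  have m3: "mset_set ?D' = mset_set (D - T) + mset_set ((T - X)\<inverse>)"
    unfolding D' using fin disj by (intro mset_set_Union) auto
  have "splits (mset_set ?D' + mset_set X + image_mset prod.swap (mset_set X)) n"
    using assms(4) unfolding D_def[symmetric] m3 image_swap_mset_set[OF fin(3)] m1 m2
    by (simp add: ac_simps)
  moreover have "(x, x) \<notin> X" for x
    using TD assms(2,3) by (auto simp: asym_on_def)
  ultimately obtain q where q: "n \<le> q + card X" "splits (mset_set ?D') q"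
    using splits_cancel[OF fin(3)] by blast
  have "card ?D' = card (D - T) + card (T - X)"
    using arg_cong[OF m3, of size] fin by simp
  moreover have "card D = card (D - T) + card X"
    using arg_cong[OF m1, of size] fin by simp
  moreover have "card T = card (T - X) + card X"
    using card_Diff_subset[OF fin(3) TD(2)] card_mono[OF fin(2) TD(2)] by simp
  ultimately show ?thesis
    using q by (auto simp: D_def intro!: exI[of _ q])
qed

section \<open>Tournaments and the cost of a reversal\<close>

lemma tournament_subset: "tournament I G \<Longrightarrow> G \<subseteq> I \<times> I"
  unfolding tournament_def by (elim conjE)

lemma tournament_finite: "tournament I G \<Longrightarrow> finite I \<Longrightarrow> finite G"
  using tournament_subset[of I G] finite_cartesian_product[of I I]
  by (metis finite_subset)

lemma tournament_iff:
  "tournament I G \<Longrightarrow> i \<in> I \<Longrightarrow> j \<in> I \<Longrightarrow> i \<noteq> j \<Longrightarrow> (i, j) \<in> G \<longleftrightarrow> (j, i) \<notin> G"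
  unfolding tournament_def by (elim conjE) (drule (1) bspec, drule (1) bspec, erule (1) mp)

lemma tournament_irrefl: "tournament I G \<Longrightarrow> (i, i) \<notin> G"
  unfolding tournament_def by (elim conjE) (erule irreflD)

lemma tournament_mem:
  assumes "tournament I G" "(i, j) \<in> G"
  shows "i \<in> I \<and> j \<in> I \<and> i \<noteq> j"
  using tournament_subset[OF assms(1)] tournament_irrefl[OF assms(1), of i] assms(2) by blast

lemma tournament_asym:
  assumes "tournament I G"
  shows "asym G"
proof (rule asymI)
  fix x y assume xy: "(x, y) \<in> G"
  from tournament_mem[OF assms this] tournament_iff[OF assms, of x y] xy show "(y, x) \<notin> G"
    by simp
qed

lemma three_cycle_card: "three_cycle G T \<Longrightarrow> card T = 3"
  unfolding three_cycle_def by (elim conjE exE) simp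

lemma three_cycle_splits: "three_cycle G T \<Longrightarrow> splits (mset_set (T\<inverse>)) 1"
proof -
  assume "three_cycle G T"
  then obtain a b c where d: "distinct [a, b, c]" and T: "T = {(a, b), (b, c), (c, a)}"
    unfolding three_cycle_def by blast
  have Ti: "T\<inverse> = {(a, c), (c, b), (b, a)}"
    using T by auto
  then have "mset_set (T\<inverse>) = {#(a, c), (c, b), (b, a)#}"
    unfolding Ti using d by auto
  moreover have "arc_trail a {#(a, c), (c, b), (b, a)#} a"
    by (auto intro!: arc_trail.intros)
  ultimately show ?thesis
    using splits_closed[of a "{#(a, c), (c, b), (b, a)#}"] by simp
qed

text \<open>Starting from \<open>q\<close> parts of the difference, \<open>n = q + 1\<close> raises
  the cost bound by one and \<open>n = q + 2\<close> lowers it by one.\<close>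

lemma cost_reversal:
  assumes "finite I" "tournament I G" "tournament I P" "three_cycle G T"
    and "splits (mset_set (G - P) + mset_set (T\<inverse>)) n" "card (G - P) + 3 \<le> m + 2 * n"
  shows "cost_le ((G - T) \<union> T\<inverse> - P) m"
proof -
  have T: "T \<subseteq> G"
    using assms(4) by (simp add: three_cycle_def)
  have "(x, y) \<in> P \<longleftrightarrow> (y, x) \<notin> P" if "(x, y) \<in> T" for x y
    using that T tournament_mem[OF assms(2), of x y] tournament_iff[OF assms(3), of x y] by blast
  from splits_reversal[OF tournament_finite[OF assms(2,1)] tournament_asym[OF assms(2)] T assms(5) this]
  obtain q where "splits (mset_set ((G - T) \<union> T\<inverse> - P)) q"
    "card ((G - T) \<union> T\<inverse> - P) + 2 * n \<le> card (G - P) + card T + 2 * q"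
    by blast
  then show ?thesis
    using assms(6) three_cycle_card[OF assms(4)] by (auto simp: cost_le_def intro!: exI[of _ q])
qed

lemma cost_le_Suc:
  assumes "finite I" "tournament I G" "tournament I P" "reversal G H" "cost_le (G - P) n"
  shows "cost_le (H - P) (Suc n)"
proof -
  obtain T where T: "three_cycle G T" "H = (G - T) \<union> T\<inverse>"
    using assms(4) by (auto simp: reversal_def)
  obtain q where q: "splits (mset_set (G - P)) q" "card (G - P) \<le> n + 2 * q"
    using assms(5) by (auto simp: cost_le_def)
  have "splits (mset_set (G - P) + mset_set (T\<inverse>)) (Suc q)"
    using splits_union[OF three_cycle_splits[OF T(1)] q(1)] by simp
  then show ?thesis
    unfolding T(2) using q(2) by (intro cost_reversal[OF assms(1-3) T(1)]) auto
qed

section \<open>Triangles along a cycle\<close>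

lemma vwalk_arcs_append_Cons: "vwalk_arcs (xs @ y # zs) = vwalk_arcs (xs @ [y]) @ vwalk_arcs (y # zs)"
proof (induction xs)
  case (Cons x xs)
  then show ?case
    by (cases xs) auto
qed simp

lemma arc_trail_vwalk: "p \<noteq> [] \<Longrightarrow> arc_trail (hd p) (mset (vwalk_arcs p)) (last p)"
proof (induction p rule: vwalk_arcs.induct)
  case (3 x y xs)
  then show ?case
    by (auto intro: arc_trail_add)
qed (auto intro: arc_trail_empty)

lemma arc_trail_Cons_snoc: "arc_trail x (mset (vwalk_arcs (x # xs @ [y]))) y"
  using arc_trail_vwalk[of "x # xs @ [y]"] by simp

lemma arc_trail_imp_vwalk:
  assumes "arc_trail a M b"
  shows "\<exists>p. p \<noteq> [] \<and> hd p = a \<and> last p = b \<and> M = mset (vwalk_arcs p)"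
  using assms
proof (induction rule: arc_trail.induct)
  case (arc_trail_empty a)
  then show ?case
    by (intro exI[of _ "[a]"]) simp
next
  case (arc_trail_add b M c a)
  then obtain p where "p \<noteq> []" "hd p = b" "last p = c" "M = mset (vwalk_arcs p)"
    by blast
  then show ?case
    by (intro exI[of _ "a # p"]) simp
qed

section \<open>Cycles as vertex lists\<close>

definition cycle_arcs :: "'a list \<Rightarrow> ('a \<times> 'a) list" where
  "cycle_arcs p = vwalk_arcs (p @ [hd p])"

lemma length_vwalk_arcs: "length (vwalk_arcs p) = length p - 1"
  unfolding vwalk_length_def[symmetric] by (rule vwalk_length_simp)

lemma length_cycle_arcs: "length (cycle_arcs p) = length p"
  by (simp add: cycle_arcs_def length_vwalk_arcs)

lemma cycle_arcs_subset: "p \<noteq> [] \<Longrightarrow> set (cycle_arcs p) \<subseteq> set p \<times> set p"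
  using arcs_in_vwalk_arcs[of _ "p @ [hd p]"] by (fastforce simp: cycle_arcs_def)

lemma cycle_arcs_rotate:
  assumes "u \<in> set p" "distinct p"
  shows "\<exists>q. mset (cycle_arcs (u # q)) = mset (cycle_arcs p) \<and> distinct (u # q) \<and> set (u # q) = set p"
proof -
  obtain xs ys where p: "p = xs @ u # ys"
    using split_list[OF assms(1)] by blast
  show ?thesis
  proof (cases xs)
    case Nil
    then show ?thesis
      using p assms by (intro exI[of _ ys]) auto
  next
    case (Cons h xs')
    have "mset (cycle_arcs (u # ys @ xs)) = mset (cycle_arcs p)"
      using vwalk_arcs_append_Cons[of "u # ys" h "xs' @ [u]"] vwalk_arcs_append_Cons[of "h # xs'" u "ys @ [h]"]
      by (simp add: cycle_arcs_def p Cons)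
    then show ?thesis
      using p assms by (intro exI[of _ "ys @ xs"]) auto
  qed
qed

lemma distinct_vwalk_arcs_fun:
  assumes "distinct p" "(x, y) \<in> set (vwalk_arcs (p @ [z]))" "(x, y') \<in> set (vwalk_arcs (p @ [z]))"
  shows "y = y'"
  using assms
proof (induction p)
  case (Cons a p)
  have "fst ` set (vwalk_arcs (p @ [z])) \<subseteq> set p"
    by (induction p) auto
  then show ?case
    using Cons by force
qed simp

lemma cycle_arcs_hd:
  assumes "distinct (u # q)" "(u, y) \<in> set (cycle_arcs (u # q))"
  shows "y = hd (q @ [u])"
  using distinct_vwalk_arcs_fun[OF assms(1), of u y u "hd (q @ [u])"] assms(2)
  by (simp add: cycle_arcs_def)

text \<open>Let \<open>w\<close> be the last out-neighbour of \<open>u\<close> along the cycle. The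
  vertex before \<open>u\<close> is an in-neighbour, so \<open>w\<close> has a successor
  \<open>w'\<close> other than \<open>u\<close>; as \<open>w'\<close> is no out-neighbour of
  \<open>u\<close>, the arc \<open>(w', u)\<close> is in \<open>G\<close>. If \<open>(u, w)\<close>
  is a cycle arc, \<open>w\<close> is both the first and the last out-neighbour, hence the only
  one.\<close>

lemma apex_triangle:
  assumes "tournament I G" "set (cycle_arcs (u # q)) \<subseteq> G" "set (u # q) \<subseteq> I" "distinct (u # q)" "q \<noteq> []"
  obtains w w' A B where "w \<in> set q" "w' \<in> set q" "(u, w) \<in> G" "(w, w') \<in> set (cycle_arcs (u # q))" "(w', u) \<in> G"
    "arc_trail u A w" "arc_trail w' B u" "mset (cycle_arcs (u # q)) = add_mset (w, w') (A + B)"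
    "(u, w) \<in> set (cycle_arcs (u # q)) \<longrightarrow> (\<forall>x\<in>set q. (u, x) \<in> G \<longrightarrow> x = w)"
proof -
  have "(u, hd q) \<in> G"
    using assms(2,5) by (cases q) (auto simp: cycle_arcs_def)
  then have "\<exists>x\<in>set q. (u, x) \<in> G"
    using assms(5) by (intro bexI[of _ "hd q"]) auto
  then obtain q1 w q2 where q: "q = q1 @ w # q2" and w: "(u, w) \<in> G" and q2: "\<forall>x\<in>set q2. (u, x) \<notin> G"
    using split_list_last_prop[of q "\<lambda>x. (u, x) \<in> G"] by blast
  have "(last q, u) \<in> G"
    using assms(2,5) vwalk_arcs_append[of q "[u]"] by (simp add: cycle_arcs_def)
  then have "q2 \<noteq> []"
    using w q tournament_asym[OF assms(1)] by (auto simp: asym_on_def)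
  then obtain w' q3 where q2': "q2 = w' # q3"
    by (cases q2) auto
  have arcs: "cycle_arcs (u # q) = vwalk_arcs (u # q1 @ [w]) @ (w, w') # vwalk_arcs (w' # q3 @ [u])"
    using vwalk_arcs_append_Cons[of "u # q1" w "w' # q3 @ [u]"] by (simp add: cycle_arcs_def q q2')
  have "(w', u) \<in> G"
    using tournament_iff[OF assms(1), of w' u] q2 assms(3,4) by (auto simp: q q2')
  moreover have "\<forall>x\<in>set q. (u, x) \<in> G \<longrightarrow> x = w" if "(u, w) \<in> set (cycle_arcs (u # q))"
  proof -
    have "w = hd q"
      using cycle_arcs_hd[OF assms(4) that] assms(5) by simp
    then have "q1 = []"
      using assms(4) by (cases q1) (auto simp: q)
    then show ?thesis
      using q2 by (auto simp: q)
  qed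
  ultimately show ?thesis
    using that[of w w' "mset (vwalk_arcs (u # q1 @ [w]))" "mset (vwalk_arcs (w' # q3 @ [u]))"] w
      arc_trail_Cons_snoc[of u q1 w] arc_trail_Cons_snoc[of w' q3 u] arcs
    by (auto simp: q q2')
qed

text \<open>The cycle is one closed trail, so three trails mean the gain of two that lowers the
  cost. Confinement to \<open>set p\<close> and the shared cycle arc tell these triangles apart from
  those of the other parts.\<close>

definition cycle_triangles :: "'a rel \<Rightarrow> 'a list \<Rightarrow> 'a rel set" where
  "cycle_triangles G p = {T. three_cycle G T \<and> T \<subseteq> set p \<times> set p \<and> T \<inter> set (cycle_arcs p) \<noteq> {} \<and>
     splits (mset (cycle_arcs p) + mset_set (T\<inverse>)) 3}"

text \<open>Three vertices whose only out-neighbours on the cycle are their successors would form a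
  triangle of cycle arcs.\<close>

lemma card_restricted_outdegree:
  assumes "tournament I G" "set p \<subseteq> I" "distinct p" "length p \<noteq> 3"
  shows "card {x \<in> set p. \<forall>y\<in>set p. (x, y) \<in> G \<longrightarrow> (x, y) \<in> set (cycle_arcs p)} \<le> 2" (is "card ?B \<le> 2")
proof (rule ccontr)
  define C where "C = set (cycle_arcs p)"
  define B where "B = ?B"
  assume "\<not> card ?B \<le> 2"
  then have "3 \<le> card B"
    unfolding B_def by linarith
  then obtain B' where B': "B' \<subseteq> B" "card B' = 3"
    using obtain_subset_with_card_n by metis
  then obtain x y z where xyz: "x \<in> B" "y \<in> B" "z \<in> B" "x \<noteq> y" "y \<noteq> z" "x \<noteq> z"
    unfolding card_3_iff by blast
  have arc_fun: "b = c" if "(a, b) \<in> C" "(a, c) \<in> C" for a b c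
    using distinct_vwalk_arcs_fun[OF assms(3)] that unfolding C_def cycle_arcs_def by blast
  have arc: "(a, b) \<in> C \<or> (b, a) \<in> C" if "a \<in> B" "b \<in> B" "a \<noteq> b" for a b
  proof -
    have ab: "a \<in> set p" "b \<in> set p" "(a, b) \<in> G \<Longrightarrow> (a, b) \<in> C" "(b, a) \<in> G \<Longrightarrow> (b, a) \<in> C"
      using that unfolding B_def C_def by blast+
    then show ?thesis
      using tournament_iff[OF assms(1) _ _ that(3)] assms(2) by blast
  qed
  \<comment> \<open>As successors on the cycle are unique, the three arcs joining \<open>x\<close>,
    \<open>y\<close>, \<open>z\<close> are oriented cyclically.\<close>
  have "\<exists>a b c. distinct [a, b, c] \<and> (a, b) \<in> C \<and> (b, c) \<in> C \<and> (c, a) \<in> C"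
  proof (cases "(x, y) \<in> C")
    case True
    then have "(y, z) \<in> C" "(z, x) \<in> C"
      using arc[of x z] arc[of y z] arc_fun xyz by metis+
    then show ?thesis
      using True xyz by (intro exI[of _ x] exI[of _ y] exI[of _ z]) simp
  next
    case False
    then have yx: "(y, x) \<in> C"
      using arc[of x y] xyz by blast
    then have "(x, z) \<in> C" "(z, y) \<in> C"
      using arc[of x z] arc[of y z] arc_fun xyz by metis+
    then show ?thesis
      using yx xyz by (intro exI[of _ y] exI[of _ x] exI[of _ z]) simp
  qed
  then obtain a b c where abc: "distinct [a, b, c]" "(a, b) \<in> C" "(b, c) \<in> C" "(c, a) \<in> C"
    by blast
  have "p \<noteq> []"
    using xyz by (auto simp: B_def)
  then have "a \<in> set p"
    using cycle_arcs_subset[of p] abc(2) by (auto simp: C_def)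
  then obtain q where q: "mset (cycle_arcs (a # q)) = mset (cycle_arcs p)" "distinct (a # q)" "set (a # q) = set p"
    using cycle_arcs_rotate[OF _ assms(3)] by blast
  have sq: "set (cycle_arcs (a # q)) = C"
    using q(1) mset_eq_setD unfolding C_def by blast
  have len: "length p = length (a # q)"
    using q(2,3) assms(3) distinct_card by metis
  have fun': "y = y'" if "(x, y) \<in> set (vwalk_arcs (a # q @ [a]))" "(x, y') \<in> C" for x y y'
    using arc_fun[of x y y'] that sq by (auto simp: cycle_arcs_def)
  \<comment> \<open>Read from \<open>a\<close>, the cycle runs through \<open>b\<close> and
    \<open>c\<close> and returns to \<open>a\<close> at once, so it has length 3.\<close>
  obtain q' where q': "q = b # q'"
    using fun'[of a "hd (q @ [a])" b] abc by (cases q) auto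
  obtain q'' where q'': "q' = c # q''"
    using fun'[of b "hd (q' @ [a])" c] abc q' by (cases q') auto
  have "q'' = []"
    using fun'[of c "hd (q'' @ [a])" a] abc q' q'' q(2) by (cases q'') auto
  then show False
    using len assms(4) q' q'' by simp
qed

lemma cycle_triangles_apex:
  assumes "tournament I G" "set (cycle_arcs p) \<subseteq> G" "set p \<subseteq> I" "distinct p" "u \<in> set p" "length p \<ge> 3"
  shows "\<exists>w w'. {(u, w), (w, w'), (w', u)} \<in> cycle_triangles G p \<and> distinct [u, w, w'] \<and>
    (w, w') \<in> set (cycle_arcs p) \<and>
    ((u, w) \<in> set (cycle_arcs p) \<longrightarrow> (\<forall>x\<in>set p. (u, x) \<in> G \<longrightarrow> (u, x) \<in> set (cycle_arcs p)))"
proof -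
  obtain q where q: "mset (cycle_arcs (u # q)) = mset (cycle_arcs p)" "distinct (u # q)" "set (u # q) = set p"
    using cycle_arcs_rotate[OF assms(5,4)] by blast
  have sq: "set (cycle_arcs (u # q)) = set (cycle_arcs p)"
    using q(1) mset_eq_setD by blast
  have "length p = length (u # q)"
    using q(2,3) assms(4) distinct_card by metis
  then have ne: "q \<noteq> []"
    using assms(6) by auto
  have sub: "set (cycle_arcs (u # q)) \<subseteq> G" "set (u # q) \<subseteq> I"
    using assms(2,3) sq q(3) by simp_all
  obtain w w' A B where w: "w \<in> set q" "w' \<in> set q" "(u, w) \<in> G"
      "(w, w') \<in> set (cycle_arcs (u # q))" "(w', u) \<in> G"
    and AB: "arc_trail u A w" "arc_trail w' B u" "mset (cycle_arcs (u # q)) = add_mset (w, w') (A + B)"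
    and out: "(u, w) \<in> set (cycle_arcs (u # q)) \<longrightarrow> (\<forall>x\<in>set q. (u, x) \<in> G \<longrightarrow> x = w)"
    using apex_triangle[OF assms(1) sub q(2) ne] by blast
  let ?T = "{(u, w), (w, w'), (w', u)}"
  have "w \<noteq> w'"
    using w(4) sq assms(2) tournament_irrefl[OF assms(1)] by blast
  then have dist: "distinct [u, w, w']"
    using w(1,2) q(2) by auto
  have Tc: "?T\<inverse> = {(w, u), (w', w), (u, w')}"
    by auto
  have "mset_set (?T\<inverse>) = {#(w, u), (w', w), (u, w')#}"
    unfolding Tc using dist by auto
  \<comment> \<open>The paths from \<open>u\<close> to \<open>w\<close> and from \<open>w'\<close>
    to \<open>u\<close> are closed by \<open>(w, u)\<close> and \<open>(u, w')\<close>; the two arcs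
    left over form a 2-cycle.\<close>
  then have eq: "mset (cycle_arcs p) + mset_set (?T\<inverse>) =
      (A + {#(w, u)#}) + {#(w, w'), (w', w)#} + (B + {#(u, w')#})"
    using AB(3) q(1) by simp
  have "splits (A + {#(w, u)#}) 1"
    using splits_closed[OF arc_trail_append[OF AB(1) arc_trail_single]] by simp
  moreover have "arc_trail w {#(w, w'), (w', w)#} w"
    by (auto intro: arc_trail.intros)
  moreover have "arc_trail w' (B + {#(u, w')#}) w'"
    by (rule arc_trail_append[OF AB(2) arc_trail_single])
  ultimately have "splits (mset (cycle_arcs p) + mset_set (?T\<inverse>)) (Suc (Suc 1))"
    unfolding eq by (intro splits_add) auto
  moreover have "three_cycle G ?T"
    using dist w sq assms(2) unfolding three_cycle_def by blast
  moreover have "?T \<subseteq> set p \<times> set p"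
    using w q(3) by auto
  ultimately have "?T \<in> cycle_triangles G p"
    using w(4) sq by (auto simp: cycle_triangles_def eval_nat_numeral)
  moreover have "\<forall>x\<in>set p. (u, x) \<in> G \<longrightarrow> (u, x) \<in> set (cycle_arcs p)" if "(u, w) \<in> set (cycle_arcs p)"
    using out that sq q(3) tournament_irrefl[OF assms(1), of u] by auto
  ultimately show ?thesis
    using dist w(4) sq by blast
qed

lemma card_cycle_triangles:
  assumes "tournament I G" "set (cycle_arcs p) \<subseteq> G" "set p \<subseteq> I" "distinct p"
  shows "finite (cycle_triangles G p)" "length p \<le> card (cycle_triangles G p) + 2"
proof -
  show fin: "finite (cycle_triangles G p)"
    by (rule finite_subset[of _ "Pow (set p \<times> set p)"]) (auto simp: cycle_triangles_def)
  let ?C = "set (cycle_arcs p)"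
  define B where "B = {x \<in> set p. \<forall>y\<in>set p. (x, y) \<in> G \<longrightarrow> (x, y) \<in> ?C}"
  consider "length p \<le> 2" | "length p = 3" | "length p \<ge> 4"
    by linarith
  then show "length p \<le> card (cycle_triangles G p) + 2"
  proof cases
    case 2
    then have "hd p \<in> set p"
      by (intro hd_in_set) auto
    then have "cycle_triangles G p \<noteq> {}"
      using cycle_triangles_apex[OF assms, of "hd p"] 2 by auto
    then have "card (cycle_triangles G p) > 0"
      using fin by (simp add: card_gt_0_iff)
    then show ?thesis
      using 2 by simp
  next
    case 3
    have "\<exists>w w'. {(u, w), (w, w'), (w', u)} \<in> cycle_triangles G p \<and> distinct [u, w, w'] \<and>
        (w, w') \<in> ?C \<and> ((u, w) \<in> ?C \<longrightarrow> u \<in> B)" if "u \<in> set p" for u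
      using cycle_triangles_apex[OF assms that] 3 that by (auto simp: B_def)
    then obtain f g where fg: "\<And>u. u \<in> set p \<Longrightarrow> {(u, f u), (f u, g u), (g u, u)} \<in> cycle_triangles G p \<and>
        distinct [u, f u, g u] \<and> (f u, g u) \<in> ?C \<and> ((u, f u) \<in> ?C \<longrightarrow> u \<in> B)"
      by metis
    \<comment> \<open>Outside \<open>B\<close> the arc leaving the apex is off the cycle and the
      next arc is on it. If two apexes shared a triangle, some arc would have to be both.\<close>
    have inj: "inj_on (\<lambda>u. {(u, f u), (f u, g u), (g u, u)}) (set p - B)"
    proof (rule inj_onI)
      fix u v assume u: "u \<in> set p - B" and v: "v \<in> set p - B"
        and eq: "{(u, f u), (f u, g u), (g u, u)} = {(v, f v), (f v, g v), (g v, v)}"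
      have "(v, f v) \<in> {(u, f u), (f u, g u), (g u, u)}" "(f v, g v) \<in> {(u, f u), (f u, g u), (g u, u)}"
        unfolding eq by auto
      then show "u = v"
        using fg[of u] fg[of v] u v by auto
    qed
    have "card (set p - B) \<le> card (cycle_triangles G p)"
      using fg by (intro card_inj_on_le[OF inj _ fin]) auto
    moreover have "card B \<le> 2"
      using card_restricted_outdegree[OF assms(1,3,4)] 3 by (simp add: B_def)
    moreover have "card (set p - B) = length p - card B"
      using distinct_card[OF assms(4)] by (subst card_Diff_subset) (auto simp: B_def)
    ultimately show ?thesis
      by linarith
  qed simp
qed

section \<open>Optimal decompositions\<close>

lemma set_vertices_cycle_arcs: "fst ` set (vwalk_arcs (p @ [z])) = set p"
  by (induction p) auto

text \<open>Submultisets of a set are free of repetitions; this turns the rest of a decomposition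
  back into a relation for the recursion.\<close>

lemma mset_set_union_right:
  assumes "finite D" "mset_set D = N + C"
  shows "mset_set (set_mset C) = C" "set_mset C \<subseteq> D"
proof -
  have le: "count C x \<le> count (mset_set D) x" for x
    using assms(2) by simp
  show "mset_set (set_mset C) = C"
  proof (rule multiset_eqI)
    fix x
    have "count C x \<le> 1"
      using le[of x] by (simp add: count_mset_set' split: if_splits)
    then show "count (mset_set (set_mset C)) x = count C x"
      by (cases "x \<in># C") (simp_all add: count_mset_set' not_in_iff le_antisym)
  qed
  show "set_mset C \<subseteq> D"
    using assms by (metis finite_set_mset_mset_set set_mset_union sup_ge2)
qed

text \<open>The part is optimal only if \<open>Suc r\<close> is the maximal number of parts of \<open>D\<close>.\<close>

definition optimal_part :: "'a rel \<Rightarrow> nat \<Rightarrow> ('a \<times> 'a) multiset \<Rightarrow> bool" where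
  "optimal_part D r C \<longleftrightarrow> (\<exists>N a. mset_set D = N + C \<and> splits N r \<and> arc_trail a C a \<and> C \<noteq> {#})"

text \<open>At a repeated vertex the part would split into two nonempty closed trails, giving
  \<open>r + 2\<close> parts in all.\<close>

lemma optimal_part_cycle:
  assumes "\<And>n. splits (mset_set D) n \<Longrightarrow> n \<le> Suc r" "optimal_part D r C"
  shows "\<exists>p. p \<noteq> [] \<and> distinct p \<and> C = mset (cycle_arcs p)"
proof -
  obtain N a where N: "mset_set D = N + C" "splits N r" "arc_trail a C a" "C \<noteq> {#}"
    using assms(2) unfolding optimal_part_def by blast
  obtain v where v: "v \<noteq> []" "hd v = a" "last v = a" "C = mset (vwalk_arcs v)"
    using arc_trail_imp_vwalk[OF N(3)] by blast
  then obtain p where vp: "v = p @ [a]"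
    by (metis append_butlast_last_id)
  then have p: "p \<noteq> []" "hd p = a" "C = mset (cycle_arcs p)"
    using v N(4) by (cases p; auto simp: cycle_arcs_def)+
  have "distinct p"
  proof (rule ccontr)
    assume "\<not> distinct p"
    then obtain xs ys zs y where d: "p = xs @ [y] @ ys @ [y] @ zs"
      using not_distinct_decomp by blast
    define K1 where "K1 = mset (vwalk_arcs (y # ys @ [y]))"
    define K2 where "K2 = mset (vwalk_arcs (xs @ [y])) + mset (vwalk_arcs (y # zs @ [a]))"
    have "C = K1 + K2"
      using vwalk_arcs_append_Cons[of xs y "ys @ y # zs @ [a]"] vwalk_arcs_append_Cons[of "y # ys" y "zs @ [a]"]
      by (simp add: v(4) vp d K1_def K2_def)
    moreover have "arc_trail y K1 y"
      unfolding K1_def by (rule arc_trail_Cons_snoc)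
    moreover have "hd (xs @ [y]) = a"
      using p(2) d by (cases xs) auto
    then have "arc_trail a K2 a"
      using arc_trail_append[OF _ arc_trail_Cons_snoc[of y zs a]] arc_trail_vwalk[of "xs @ [y]"] unfolding K2_def by auto
    moreover have "K1 \<noteq> {#}" "K2 \<noteq> {#}"
      by (simp_all add: K1_def K2_def)
    ultimately have "splits (N + K1 + K2) (Suc (Suc r))" "mset_set D = N + K1 + K2"
      using splits_add[OF splits_add[OF N(2)]] N(1) by (blast, simp)
    then show False
      using assms(1) by fastforce
  qed
  then show ?thesis
    using p by blast
qed

text \<open>If a part of an optimal decomposition has a chord in \<open>D\<close>, the chord can be exchanged with the
  path it cuts off, so a part of minimal size is an induced cycle of \<open>D\<close>.\<close>

lemma minimal_part_induced:
  assumes "finite D" "irrefl D" "mset_set D = N + mset (cycle_arcs p)" "splits N r" "distinct p"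
    and min: "\<And>C. optimal_part D r C \<Longrightarrow> length p \<le> size C"
    and xy: "x \<in> set p" "y \<in> set p"
  shows "(x, y) \<notin># N"
proof
  assume xyN: "(x, y) \<in># N"
  then have "(x, y) \<in># mset_set D"
    using assms(3) by simp
  then have "(x, y) \<in> D"
    using assms(1) by simp
  then have "x \<noteq> y"
    using assms(2) by (auto simp: irrefl_on_def)
  obtain N' L m where N': "splits N' m" "r = Suc m" "arc_trail y L x" "N = add_mset (x, y) (N' + L)"
    using splits_part[OF assms(4) xyN] by blast
  obtain q where q: "mset (cycle_arcs (x # q)) = mset (cycle_arcs p)" "distinct (x # q)" "set (x # q) = set p"
    using cycle_arcs_rotate[OF xy(1) assms(5)] by blast
  have "y \<in> set q"
    using q(3) xy(2) \<open>x \<noteq> y\<close> by auto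
  then obtain q1 q2 where q12: "q = q1 @ y # q2"
    using split_list by metis
  define A where "A = mset (vwalk_arcs (x # q1 @ [y]))"
  define B where "B = mset (vwalk_arcs (y # q2 @ [x]))"
  have AB: "mset (cycle_arcs p) = A + B"
    using vwalk_arcs_append_Cons[of "x # q1" y "q2 @ [x]"] q(1)[symmetric]
    by (simp add: cycle_arcs_def q12 A_def B_def)
  have D: "mset_set D = add_mset (x, y) (N' + L + A + B)"
    using assms(3) AB N'(4) by (simp add: ac_simps)
  have tA: "arc_trail x A y"
    unfolding A_def by (rule arc_trail_Cons_snoc)
  \<comment> \<open>\<open>L\<close> is the part through the chord without the chord;
    \<open>A\<close> and \<open>B\<close> are the two sides of the cycle. Exchanging the chord with
    \<open>A\<close> keeps the number of parts.\<close>
  have "arc_trail y (L + A) y"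
    using arc_trail_append[OF N'(3) tA] .
  moreover have "L + A \<noteq> {#}"
    by (simp add: A_def)
  ultimately have "splits (N' + (L + A)) r"
    unfolding N'(2) using splits_add[OF N'(1)] by blast
  moreover have "arc_trail x (add_mset (x, y) B) x"
    unfolding B_def by (intro arc_trail_add arc_trail_Cons_snoc)
  moreover have "mset_set D = N' + (L + A) + add_mset (x, y) B"
    using D by (simp add: ac_simps)
  ultimately have "optimal_part D r (add_mset (x, y) B)"
    unfolding optimal_part_def by (intro exI[of _ "N' + (L + A)"] exI[of _ x]) simp
  \<comment> \<open>Minimality makes \<open>A\<close> no longer than the chord, so \<open>A\<close>
    is the chord itself, which then occurs twice in the set \<open>D\<close>.\<close>
  from min[OF this] have "size (mset (cycle_arcs p)) \<le> size (add_mset (x, y) B)"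
    by (simp add: length_cycle_arcs)
  then have "size A \<le> 1"
    unfolding AB by simp
  then have "q1 = []"
    by (simp add: A_def length_vwalk_arcs)
  then have "count (mset_set D) (x, y) \<ge> 2"
    unfolding D by (simp add: A_def)
  then show False
    using assms(1) by (simp add: count_mset_set' split: if_splits)
qed

text \<open>Induction on the maximal number \<open>q\<close> of parts, removing a smallest part each
  time: a cycle of length \<open>l\<close> supplies at least \<open>l - 2\<close> triangles, which
  add up to \<open>card D - 2 * q\<close>. The clause \<open>T \<inter> D \<noteq> {}\<close> keeps
  triangles of different parts distinct.\<close>

lemma improving_triangles:
  assumes "finite I" "tournament I G" "D \<subseteq> G" "splits (mset_set D) q"
    and "\<And>n. splits (mset_set D) n \<Longrightarrow> n \<le> q"
  shows "\<exists>S. finite S \<and> card D \<le> card S + 2 * q \<and>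
    (\<forall>T\<in>S. three_cycle G T \<and> T \<inter> D \<noteq> {} \<and> splits (mset_set D + mset_set (T\<inverse>)) (q + 2))"
  using assms(3-5)
proof (induction q arbitrary: D)
  case 0
  have "finite D"
    using 0 tournament_finite[OF assms(2,1)] finite_subset by blast
  then have "D = {}"
    using splits_0D[OF 0(2)] by (simp add: mset_set_empty_iff)
  then show ?case
    by (intro exI[of _ "{}"]) simp
next
  case (Suc r)
  have fin: "finite D"
    using Suc.prems(1) tournament_finite[OF assms(2,1)] finite_subset by blast
  have "\<exists>C. optimal_part D r C"
    using Suc.prems(2) by (cases rule: splits.cases) (auto simp: optimal_part_def)
  \<comment> \<open>The minimum is over the parts of all optimal decompositions, as the exchange
    along a chord changes the decomposition.\<close>
  then obtain C where C: "optimal_part D r C" and min: "\<And>C'. optimal_part D r C' \<Longrightarrow> size C \<le> size C'"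
    using ex_has_least_nat[of "optimal_part D r" _ size] by blast
  obtain N a where N: "mset_set D = N + C" "splits N r" "arc_trail a C a" "C \<noteq> {#}"
    using C unfolding optimal_part_def by blast
  obtain p where p: "p \<noteq> []" "distinct p" "C = mset (cycle_arcs p)"
    using optimal_part_cycle[OF Suc.prems(3) C] by blast
  define D' where "D' = set_mset N"
  have D': "mset_set D' = N" "D' \<subseteq> D"
    using mset_set_union_right[OF fin, of C N] N(1) by (simp_all add: D'_def add.commute)
  have CD: "set (cycle_arcs p) \<subseteq> D"
    using mset_set_union_right(2)[OF fin N(1)] p(3) by simp
  have induced: "(x, y) \<notin> D'" if "x \<in> set p" "y \<in> set p" for x y
  proof -
    have "irrefl D"
      using Suc.prems(1) tournament_irrefl[OF assms(2)] by (auto simp: irrefl_on_def)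
    then show ?thesis
      using minimal_part_induced[OF fin _ _ N(2) p(2) _ that] N(1) p(3) min
      by (simp add: D'_def length_cycle_arcs)
  qed
  have max: "n \<le> r" if "splits (mset_set D') n" for n
    using Suc.prems(3)[of "Suc n"] splits_add[OF that N(3,4)] D'(1) N(1) by simp
  have "D' \<subseteq> G" "splits (mset_set D') r"
    using D' Suc.prems(1) N(2) by auto
  from Suc.IH[OF this max] obtain S' where S': "finite S'" "card D' \<le> card S' + 2 * r"
    "\<And>T. T \<in> S' \<Longrightarrow> three_cycle G T \<and> T \<inter> D' \<noteq> {} \<and> splits (mset_set D' + mset_set (T\<inverse>)) (r + 2)"
    by blast
  let ?F = "cycle_triangles G p"
  have CG: "set (cycle_arcs p) \<subseteq> G"
    using CD Suc.prems(1) by blast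
  have "set p \<subseteq> I"
    using set_vertices_cycle_arcs[of p "hd p"] CG tournament_subset[OF assms(2)]
    by (force simp: cycle_arcs_def)
  note F = card_cycle_triangles[OF assms(2) CG this p(2)]
  \<comment> \<open>A triangle of \<open>S'\<close> has an arc in \<open>D'\<close>, whereas those
    of the cycle lie within \<open>set p\<close>, where \<open>D'\<close> has no arcs.\<close>
  have disj: "S' \<inter> ?F = {}"
    using S'(3) induced by (fastforce simp: cycle_triangles_def)
  have "size N = card D'"
    using arg_cong[OF D'(1), of size] by simp
  then have "card D = card D' + length p"
    using arg_cong[OF N(1), of size] p(3) by (simp add: length_cycle_arcs)
  then have "card D \<le> card (S' \<union> ?F) + 2 * Suc r"
    using card_Un_disjoint[OF S'(1) F(1) disj] S'(2) F(2) by simp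
  moreover have "three_cycle G T \<and> T \<inter> D \<noteq> {} \<and> splits (mset_set D + mset_set (T\<inverse>)) (Suc r + 2)"
    if "T \<in> S' \<union> ?F" for T
  proof (cases "T \<in> S'")
    case True
    have "splits (mset_set D' + mset_set (T\<inverse>) + C) (Suc (r + 2))"
      using splits_add[OF _ N(3,4)] S'(3)[OF True] by blast
    moreover have "mset_set D + mset_set (T\<inverse>) = mset_set D' + mset_set (T\<inverse>) + C"
      using N(1) D'(1) by (simp add: ac_simps)
    ultimately have "splits (mset_set D + mset_set (T\<inverse>)) (Suc r + 2)"
      by (metis add_Suc)
    then show ?thesis
      using S'(3)[OF True] D'(2) by blast
  next
    case False
    then have T: "three_cycle G T" "T \<inter> set (cycle_arcs p) \<noteq> {}" "splits (C + mset_set (T\<inverse>)) 3"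
      using that p(3) by (auto simp: cycle_triangles_def)
    have "splits (N + (C + mset_set (T\<inverse>))) (r + 3)"
      using splits_union[OF T(3) N(2)] .
    then show ?thesis
      using T(1,2) CD N(1) by (auto simp: add.assoc eval_nat_numeral)
  qed
  ultimately show ?case
    using S'(1) F(1) by (intro exI[of _ "S' \<union> ?F"]) blast
qed

text \<open>Without loops and 2-cycles, every nonempty closed trail has at least three arcs.\<close>

lemma splits_tournament_size:
  assumes "splits M n" "tournament I G" "set_mset M \<subseteq> G"
  shows "3 * n \<le> size M"
  using assms(1,3)
proof (induction rule: splits.induct)
  case (splits_add M n a K)
  obtain v where v: "v \<noteq> []" "hd v = a" "last v = a" "K = mset (vwalk_arcs v)"
    using arc_trail_imp_vwalk[OF splits_add.hyps(2)] by blast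
  have "length v \<ge> 4"
  proof (rule ccontr)
    assume "\<not> length v \<ge> 4"
    then consider "v = [a]" | "v = [a, a]" | b where "v = [a, b, a]"
      using v(1-3) by (cases v rule: vwalk_arcs.cases; cases "tl (tl v)") (auto simp: Suc_le_eq split: if_splits)
    then show False
      using v(4) splits_add.hyps(3) splits_add.prems tournament_irrefl[OF assms(2)] tournament_asym[OF assms(2)]
      by cases (auto simp: asym_on_def)
  qed
  then have "size K \<ge> 3"
    using v(4) by (simp add: length_vwalk_arcs)
  then show ?case
    using splits_add by simp
qed simp

section \<open>The interchange graph\<close>

definition reverse_arcs :: "'a rel \<Rightarrow> 'a rel \<Rightarrow> 'a rel" where
  "reverse_arcs G T = (G - T) \<union> T\<inverse>"

lemma reverse_arcs_tournament:
  assumes "tournament I G" "T \<subseteq> G"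
  shows "tournament I (reverse_arcs G T)"
proof -
  have "reverse_arcs G T \<subseteq> I \<times> I" "irrefl (reverse_arcs G T)"
    using tournament_mem[OF assms(1)] assms(2) by (auto simp: reverse_arcs_def irrefl_on_def)
  moreover have "(i, j) \<in> reverse_arcs G T \<longleftrightarrow> (j, i) \<notin> reverse_arcs G T"
    if "i \<in> I" "j \<in> I" "i \<noteq> j" for i j
    using tournament_iff[OF assms(1) that] assms(2) by (auto simp: reverse_arcs_def)
  ultimately show ?thesis
    unfolding tournament_def by blast
qed

text \<open>The vertex \<open>a\<close> loses the out-neighbour \<open>b\<close> and gains
  \<open>c\<close>; rotating the triangle covers its other vertices.\<close>

lemma score_reverse_arcs_start:
  assumes "tournament I G" "finite I" "T = {(a, b), (b, c), (c, a)}" "distinct [a, b, c]" "T \<subseteq> G"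
  shows "score (reverse_arcs G T) a = score G a"
proof -
  have asym: "(c, a) \<in> G \<Longrightarrow> (a, c) \<notin> G"
    using tournament_asym[OF assms(1)] by (auto simp: asym_on_def)
  have "{j. (a, j) \<in> reverse_arcs G T} = insert c ({j. (a, j) \<in> G} - {b})"
    using assms(3-5) by (auto simp: reverse_arcs_def)
  moreover have "c \<notin> {j. (a, j) \<in> G} - {b}" "b \<in> {j. (a, j) \<in> G}"
    using assms(3,5) asym by auto
  moreover have "finite {j. (a, j) \<in> G}"
    using tournament_mem[OF assms(1)] by (intro finite_subset[OF _ assms(2)]) auto
  ultimately show ?thesis
    using card_Suc_Diff1[of "{j. (a, j) \<in> G}" b] by (simp add: score_def)
qed

lemma score_reverse_arcs:
  assumes "tournament I G" "finite I" "three_cycle G T"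
  shows "score (reverse_arcs G T) i = score G i"
proof -
  obtain a b c where T: "T = {(a, b), (b, c), (c, a)}" "distinct [a, b, c]" "T \<subseteq> G"
    using assms(3) unfolding three_cycle_def by blast
  consider "i = a" | "i = b" | "i = c" | "i \<notin> {a, b, c}"
    by blast
  then show ?thesis
  proof cases
    case 1
    then show ?thesis
      using score_reverse_arcs_start[OF assms(1,2) T] by simp
  next
    case 2
    then show ?thesis
      using score_reverse_arcs_start[OF assms(1,2), of T b c a] T by (auto simp: insert_commute)
  next
    case 3
    then show ?thesis
      using score_reverse_arcs_start[OF assms(1,2), of T c a b] T by (auto simp: insert_commute)
  next
    case 4
    then have "{j. (i, j) \<in> reverse_arcs G T} = {j. (i, j) \<in> G}"
      using T(1) by (auto simp: reverse_arcs_def)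
    then show ?thesis
      by (simp add: score_def)
  qed
qed

text \<open>The reversed triangle is a 3-cycle of the new tournament, and reversing it restores
  \<open>G\<close>; edges ask for both directions.\<close>

lemma reversal_reverse_arcs:
  assumes "tournament I G" "three_cycle G T"
  shows "reversal G (reverse_arcs G T)" "reversal (reverse_arcs G T) G"
proof -
  show "reversal G (reverse_arcs G T)"
    using assms(2) by (auto simp: reversal_def reverse_arcs_def)
  obtain a b c where T: "T = {(a, b), (b, c), (c, a)}" "distinct [a, b, c]" "T \<subseteq> G"
    using assms(2) unfolding three_cycle_def by blast
  have "T\<inverse> = {(a, c), (c, b), (b, a)}" "distinct [a, c, b]"
    using T(1,2) by auto
  moreover have "T\<inverse> \<subseteq> reverse_arcs G T"
    by (simp add: reverse_arcs_def)
  ultimately have "three_cycle (reverse_arcs G T) (T\<inverse>)"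
    unfolding three_cycle_def by blast
  moreover have "T\<inverse> \<inter> G = {}"
    using tournament_asym[OF assms(1)] T(3) by (auto simp: asym_on_def)
  then have "G = reverse_arcs (reverse_arcs G T) (T\<inverse>)"
    using T(3) by (auto simp: reverse_arcs_def)
  ultimately show "reversal (reverse_arcs G T) G"
    unfolding reversal_def reverse_arcs_def by blast
qed

text \<open>\<open>T\<close> is recovered as the arcs that \<open>G\<close> loses, so distinct
  triangles lead to distinct neighbours.\<close>

lemma inj_on_reverse_arcs:
  assumes "tournament I G"
  shows "inj_on (reverse_arcs G) {T. T \<subseteq> G}"
proof (rule inj_on_inverseI)
  fix T assume "T \<in> {T. T \<subseteq> G}"
  then show "G - reverse_arcs G T = T"
    using tournament_asym[OF assms] by (auto simp: reverse_arcs_def asym_on_def)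
qed

section \<open>Adjacency, cost along walks, and counting walks\<close>

lemma verts_interchange_graph:
  "G \<in> pverts (interchange_graph I s) \<longleftrightarrow> tournament I G \<and> (\<forall>i\<in>I. score G i = s i)"
  by (simp add: interchange_graph_def)

lemma arcs_interchange_graph:
  "(G, H) \<in> parcs (interchange_graph I s) \<longleftrightarrow> G \<in> pverts (interchange_graph I s) \<and>
    H \<in> pverts (interchange_graph I s) \<and> reversal G H \<and> reversal H G"
  by (simp add: interchange_graph_def)

lemma reverse_arcs_adjacent:
  assumes "finite I" "G \<in> pverts (interchange_graph I s)" "three_cycle G T"
  shows "(G, reverse_arcs G T) \<in> parcs (interchange_graph I s)"
proof -
  have G: "tournament I G" "T \<subseteq> G"
    using assms(2,3) by (auto simp: verts_interchange_graph three_cycle_def)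
  then show ?thesis
    using reversal_reverse_arcs[OF G(1) assms(3)] reverse_arcs_tournament[OF G]
      score_reverse_arcs[OF G(1) assms(1,3)] assms(2)
    by (simp add: arcs_interchange_graph verts_interchange_graph)
qed

text \<open>The cost is zero at \<open>P\<close> and grows by at most one per step away from it, so
  it bounds the length of walks to \<open>P\<close> from below.\<close>

lemma cost_le_walk:
  assumes "finite I" "P \<in> pverts (interchange_graph I s)"
    and "vwalk p (with_proj (interchange_graph I s))" "last p = P"
  shows "cost_le (hd p - P) (length p - 1)"
  using assms(3,4)
proof (induction rule: vwalk_induct)
  case (Base u)
  then show ?case
    by (auto simp: cost_le_def intro!: exI[of _ 0] splits_empty)
next
  case (Cons u v es)
  then have "(u, v) \<in> parcs (interchange_graph I s)"
    by simp
  then have "tournament I v" "reversal v u"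
    by (auto simp: arcs_interchange_graph verts_interchange_graph)
  moreover have "tournament I P"
    using assms(2) by (simp add: verts_interchange_graph)
  moreover have "cost_le (v - P) (length es)"
    using Cons by simp
  ultimately show ?case
    using cost_le_Suc[OF assms(1)] by simp
qed

text \<open>The least cost is exactly \<open>Suc k\<close>, so for the maximal number
  \<open>q\<close> of parts \<open>card (G - P) - 2 * q\<close> is \<open>Suc k\<close>, and that
  many improving triangles exist.\<close>

lemma many_descents:
  assumes "finite I" "tournament I G" "tournament I P"
    and "cost_le (G - P) (Suc k)" "\<not> cost_le (G - P) k"
  shows "\<exists>S. finite S \<and> Suc k \<le> card S \<and>
    (\<forall>T\<in>S. three_cycle G T \<and> cost_le (reverse_arcs G T - P) k)"
proof -
  let ?D = "G - P"
  obtain q0 where q0: "splits (mset_set ?D) q0" "card ?D \<le> Suc k + 2 * q0"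
    using assms(4) by (auto simp: cost_le_def)
  have bound: "n \<le> card ?D" if "splits (mset_set ?D) n" for n
    using splits_le_size[OF that] by simp
  define q where "q = Greatest (splits (mset_set ?D))"
  have q: "splits (mset_set ?D) q"
    unfolding q_def using q0(1) bound by (rule GreatestI_nat)
  have max: "n \<le> q" if "splits (mset_set ?D) n" for n
    unfolding q_def using that bound by (rule Greatest_le_nat)
  have card: "card ?D = Suc k + 2 * q"
  proof (rule antisym)
    show "card ?D \<le> Suc k + 2 * q"
      using q0(2) max[OF q0(1)] by linarith
    show "Suc k + 2 * q \<le> card ?D"
      using assms(5) q by (auto simp: cost_le_def not_le Suc_le_eq)
  qed
  obtain S where S: "finite S" "card ?D \<le> card S + 2 * q"
    "\<And>T. T \<in> S \<Longrightarrow> three_cycle G T \<and> splits (mset_set ?D + mset_set (T\<inverse>)) (q + 2)"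
    using improving_triangles[OF assms(1,2) Diff_subset q max] by blast
  have "cost_le (reverse_arcs G T - P) k" if "T \<in> S" for T
    unfolding reverse_arcs_def
    using S(3)[OF that] card by (intro cost_reversal[OF assms(1-3)]) auto
  then show ?thesis
    using S card by (intro exI[of _ S]) auto
qed

text \<open>Parts have at least three arcs, so \<open>3 * q \<le> card (G - P) \<le> 2 * q\<close>
  and \<open>G - P\<close> is empty; nested tournaments on the same set are equal.\<close>

lemma cost_le_0D:
  assumes "finite I" "tournament I G" "tournament I P" "cost_le (G - P) 0"
  shows "G = P"
proof -
  have fin: "finite (G - P)"
    using tournament_finite[OF assms(2,1)] by simp
  obtain q where q: "splits (mset_set (G - P)) q" "card (G - P) \<le> 2 * q"
    using assms(4) by (auto simp: cost_le_def)
  have "3 * q \<le> card (G - P)"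
    using splits_tournament_size[OF q(1) assms(2)] fin by simp
  then have "card (G - P) = 0"
    using q(2) by linarith
  then have sub: "G \<subseteq> P"
    using fin by simp
  have "(x, y) \<in> G" if "(x, y) \<in> P" for x y
    using tournament_mem[OF assms(3) that] tournament_iff[OF assms(2), of x y]
      tournament_iff[OF assms(3), of x y] that sub by blast
  then show ?thesis
    using sub by auto
qed

text \<open>Vertices may repeat, so prefixing a vertex needs no check; walks as short as the
  distance are shown to be paths later.\<close>

definition walks :: "('v, 'e) pre_digraph \<Rightarrow> 'v \<Rightarrow> 'v \<Rightarrow> nat \<Rightarrow> 'v list set" where
  "walks D u v k = {p. vwalk p D \<and> hd p = u \<and> last p = v \<and> length p = Suc k}"

lemma finite_walks: "finite (verts D) \<Longrightarrow> finite (walks D u v k)"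
  by (rule finite_subset[OF _ finite_lists_length_eq[of "verts D" "Suc k"]])
     (auto simp: walks_def vwalk_def)

text \<open>Induction on the least cost \<open>k\<close>: for positive \<open>k\<close>, at least
  \<open>k\<close> neighbours have least cost \<open>k - 1\<close>, and walks through different
  neighbours differ in their second vertex.\<close>

lemma fact_le_card_walks:
  assumes "finite I" "P \<in> pverts (interchange_graph I s)"
    and "G \<in> pverts (interchange_graph I s)" "cost_le (G - P) k" "\<And>n. cost_le (G - P) n \<Longrightarrow> k \<le> n"
  shows "fact k \<le> card (walks (with_proj (interchange_graph I s)) G P k)"
proof -
  let ?D = "with_proj (interchange_graph I s)"
  note t = verts_interchange_graph[THEN iffD1, THEN conjunct1]
  have fin: "finite (verts ?D)"
    using pair_graph_interchange_graph[OF assms(1)]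
    by (simp add: pair_graph_def pair_digraph_def pair_fin_digraph.pair_finite_verts)
  show ?thesis
    using assms(3-5)
  proof (induction k arbitrary: G)
    case 0
    have "G = P"
      using cost_le_0D[OF assms(1) t[OF 0(1)] t[OF assms(2)] 0(2)] .
    then have "[P] \<in> walks ?D G P 0"
      using assms(2) by (auto simp: walks_def vwalk_def)
    then show ?case
      using finite_walks[OF fin, of G P 0] by (simp add: card_gt_0_iff Suc_le_eq) blast
  next
    case (Suc k)
    have "\<not> cost_le (G - P) k"
      using Suc.prems(3)[of k] by auto
    then obtain S where S: "finite S" "Suc k \<le> card S"
      "\<And>T. T \<in> S \<Longrightarrow> three_cycle G T" "\<And>T. T \<in> S \<Longrightarrow> cost_le (reverse_arcs G T - P) k"
      using many_descents[OF assms(1) t[OF Suc.prems(1)] t[OF assms(2)] Suc.prems(2)] by blast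
    define W where "W T = (#) G ` walks ?D (reverse_arcs G T) P k" for T
    have arc: "(G, reverse_arcs G T) \<in> parcs (interchange_graph I s)" if "T \<in> S" for T
      using reverse_arcs_adjacent[OF assms(1) Suc.prems(1) S(3)[OF that]] .
    have card_W: "fact k \<le> card (W T)" if "T \<in> S" for T
    proof -
      have H: "reverse_arcs G T \<in> pverts (interchange_graph I s)" "reversal (reverse_arcs G T) G"
        using arc[OF that] by (auto simp: arcs_interchange_graph)
      \<comment> \<open>A smaller cost at the neighbour would give, one step back, a cost below
        \<open>Suc k\<close> at \<open>G\<close>.\<close>
      have "k \<le> n" if "cost_le (reverse_arcs G T - P) n" for n
        using Suc.prems(3)[OF cost_le_Suc[OF assms(1) t[OF H(1)] t[OF assms(2)] H(2) that]] by simp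
      from Suc.IH[OF H(1) S(4)[OF that] this] show ?thesis
        unfolding W_def by (subst card_image) auto
    qed
    have disj: "W T \<inter> W T' = {}" if "T \<in> S" "T' \<in> S" "T \<noteq> T'" for T T'
    proof -
      have "reverse_arcs G T \<noteq> reverse_arcs G T'"
        using inj_onD[OF inj_on_reverse_arcs[OF t[OF Suc.prems(1)]], of T T'] that S(3)
        by (auto simp: three_cycle_def)
      then show ?thesis
        by (auto simp: W_def walks_def)
    qed
    have "fact (Suc k) \<le> card S * fact k"
      using mult_le_mono1[OF S(2), of "fact k"] by simp
    also have "\<dots> \<le> (\<Sum>T\<in>S. card (W T))"
      using sum_bounded_below[of S "fact k" "\<lambda>T. card (W T)"] card_W by simp
    also have "\<dots> = card (\<Union>T\<in>S. W T)"
      using S(1) disj finite_walks[OF fin] by (intro card_UN_disjoint[symmetric]) (auto simp: W_def)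
    also have "\<dots> \<le> card (walks ?D G P (Suc k))"
    proof (rule card_mono[OF finite_walks[OF fin]])
      show "(\<Union>T\<in>S. W T) \<subseteq> walks ?D G P (Suc k)"
        using arc Suc.prems(1) by (auto simp: W_def walks_def intro!: vwalk_consI)
    qed
    finally show ?case .
  qed
qed

section \<open>Distances and geodesics\<close>

text \<open>The distance is defined through arc walks, geodesics through vertex walks; this passes
  from the latter to the former.\<close>

lemma (in wf_digraph) vwalk_imp_awalk:
  assumes "vwalk p G"
  shows "\<exists>q. awalk (hd p) q (last p) \<and> length q = length p - 1"
  using assms
proof (induction rule: vwalk_induct)
  case (Base u)
  then show ?case
    by (auto simp: awalk_Nil_iff)
next
  case (Cons u v es)
  then obtain q e where "awalk v q (last (v # es))" "length q = length es" "e \<in> arcs G" "tail G e = u" "head G e = v"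
    by (auto simp: arcs_ends_def arc_to_ends_def)
  then show ?case
    by (intro exI[of _ "e # q"]) (auto simp: awalk_Cons_iff)
qed

lemma (in wf_digraph) awalk_cost_unit: "awalk_cost (\<lambda>_. 1) q = real (length q)"
  by (induction q) auto

lemma (in wf_digraph) graph_distance_le:
  assumes "p \<in> walks G u v k"
  shows "graph_distance G u v \<le> ereal (real k)"
proof -
  obtain q where "awalk u q v" "length q = k"
    using vwalk_imp_awalk[of p] assms by (auto simp: walks_def)
  then show ?thesis
    using min_cost_le_walk_cost[of u q v "\<lambda>_. 1"] by (simp add: graph_distance_def awalk_cost_unit)
qed

text \<open>A finite distance forces reachability, and then a cheapest path exists.\<close>

lemma (in fin_digraph) graph_distance_attained:
  assumes "graph_distance G u v = ereal (real k)"
  shows "\<exists>p. p \<in> walks G u v k"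
proof -
  have "u \<rightarrow>\<^sup>* v"
    using \<mu>_reach_conv[of "\<lambda>_. 1" u v] assms by (simp add: graph_distance_def)
  then obtain q where "apath u q v" and q: "\<mu> (\<lambda>_. 1) u v = awalk_cost (\<lambda>_. 1) q"
    using min_cost_awalk[of u v "\<lambda>_. 1"] by auto
  then have w: "awalk u q v"
    by (simp add: apath_def)
  have "length q = k"
    using q assms by (simp add: graph_distance_def awalk_cost_unit)
  then have "awalk_verts u q \<in> walks G u v k"
    using awalk_imp_vwalk[OF w] w by (simp add: walks_def length_awalk_verts)
  then show ?thesis
    by blast
qed

text \<open>No vertex repeats, since excising the detour between two occurrences would leave a walk
  shorter than the distance.\<close>

lemma (in wf_digraph) walks_subset_geodesics:
  assumes "graph_distance G u v = ereal (real k)"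
  shows "walks G u v k \<subseteq> geodesics G u v"
proof
  fix p assume p: "p \<in> walks G u v k"
  have "distinct p"
  proof (rule ccontr)
    assume "\<not> distinct p"
    then obtain xs ys zs y where d: "p = xs @ [y] @ ys @ [y] @ zs"
      using not_distinct_decomp by blast
    define p' where "p' = xs @ y # zs"
    have arcs: "set (vwalk_arcs p') \<subseteq> set (vwalk_arcs p)"
      using vwalk_arcs_append_Cons[of xs y zs] vwalk_arcs_append_Cons[of xs y "ys @ y # zs"]
        vwalk_arcs_append_Cons[of "y # ys" y zs]
      by (auto simp: p'_def d)
    have "vwalk p' G"
      using p arcs by (auto simp: walks_def vwalk_def p'_def d)
    moreover have "hd p' = u" "last p' = v"
      using p by (auto simp: walks_def p'_def d hd_append split: if_splits)
    ultimately have "p' \<in> walks G u v (length p' - 1)"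
      by (auto simp: walks_def p'_def)
    then have "k \<le> length p' - 1"
      using graph_distance_le assms by fastforce
    then show False
      using p by (auto simp: walks_def p'_def d)
  qed
  then show "p \<in> geodesics G u v"
    using p assms by (auto simp: walks_def geodesics_def)
qed

theorem theorem5p2:
  fixes I :: "'a set" and G P :: "'a rel" and k :: nat
  assumes "finite I"
    and "tournament I G" and "tournament I P"
    and "same_scores I G P"
    and "graph_distance (with_proj (interchange_graph I (score G))) G P = ereal (real k)"
  shows "fact k \<le> card (geodesics (with_proj (interchange_graph I (score G))) G P)"
proof -
  let ?D = "with_proj (interchange_graph I (score G))"
  interpret pair_graph "interchange_graph I (score G)"
    by (rule pair_graph_interchange_graph[OF assms(1)])
  have verts: "G \<in> pverts (interchange_graph I (score G))" "P \<in> pverts (interchange_graph I (score G))"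
    using assms(2-4) by (auto simp: verts_interchange_graph same_scores_def)
  obtain p where "p \<in> walks ?D G P k"
    using graph_distance_attained[OF assms(5)] by blast
  then have k: "cost_le (G - P) k"
    using cost_le_walk[OF assms(1) verts(2), of p] by (auto simp: walks_def)
  \<comment> \<open>The distance \<open>k\<close> is the least cost \<open>m\<close>: a shortest
    walk gives \<open>m \<le> k\<close>, and the existence of a walk of length \<open>m\<close>,
    from the count below, gives \<open>k \<le> m\<close>.\<close>
  define m where "m = (LEAST n. cost_le (G - P) n)"
  have m: "cost_le (G - P) m" "\<And>n. cost_le (G - P) n \<Longrightarrow> m \<le> n"
    unfolding m_def using k by (auto intro: LeastI Least_le)
  have fact: "fact m \<le> card (walks ?D G P m)"
    using fact_le_card_walks[OF assms(1) verts(2,1) m] .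
  then have "walks ?D G P m \<noteq> {}"
    by (metis card.empty fact_ge_1 not_one_le_zero order.trans)
  then have "k \<le> m"
    using graph_distance_le assms(5) by fastforce
  with m(2)[OF k] have "m = k"
    by simp
  \<comment> \<open>This gives finiteness, without which \<open>card\<close> would take its default
    value 0.\<close>
  have "geodesics ?D G P \<subseteq> walks ?D G P k"
    using assms(5) by (auto simp: geodesics_def walks_def vpath_def vwalk_def Suc_diff_le neq_Nil_conv)
  then have "finite (geodesics ?D G P)"
    by (rule finite_subset) (rule finite_walks, simp)
  then have "card (walks ?D G P k) \<le> card (geodesics ?D G P)"
    using walks_subset_geodesics[OF assms(5)] by (intro card_mono)
  then show ?thesis
    using fact \<open>m = k\<close> by simp
qed

end
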